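(* There exist constants $c,C>0$ and $r\in(0,c_0]$, and a smooth function $\epsilon\mapsto R_0(\epsilon)$ on $[-c,c]$ with $|R_0(\epsilon)-\epsilon|\le C\epsilon^2$, such that the following holds for all $\beta=1+\epsilon+iR$ with $\epsilon\in[-c,c]$, $R\in\mathbb{R}$ and $0<|\beta-1|\le r$: - if $|R|<|R_0(\epsilon)|$, then $\operatorname{Re}h_\beta(\pm u_\beta)<0$; - if $|R|=|R_0(\epsilon)|$, then $\operatorname{Re}h_\beta(\pm u_\beta)=0$; - if $|R|>|R_0(\epsilon)|$, then $\operatorname{Re}h_\beta(\pm u_\beta)>0$.
   Context: For $\beta\in\mathbb{C}\setminus\{0\}$ let $h_\beta(u)=\frac{u^2}{2\beta}-\log\cosh u$, an even function analytic on $\mathbb{C}\setminus\bigl((-i\infty,-i\pi/2]\cup[i\pi/2,+i\infty)\bigr)$, with the branch $\log\cosh0=0$. Fix a sufficiently small constant $c_0>0$ such that for every $\beta$ with $0<|\beta-1|\le c_0$ the function $h_\beta'(u)=\frac u\beta-\tanh u$ has exactly three zeros in $|u|\le10\sqrt{c_0}$ (such $c_0$ exists); they are denoted $0,u_\beta,-u_\beta$. *)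

theory Defs
  imports "HOL-Complex_Analysis.Complex_Analysis"
begin

text \<open>All derivatives exist on \<open>S\<close>; at endpoints of an interval \<open>S\<close> they are one-sided.\<close>

definition smooth_on :: "(real \<Rightarrow> real) \<Rightarrow> real set \<Rightarrow> bool" where
  "smooth_on f S \<longleftrightarrow> (\<exists>D. (\<forall>x\<in>S. D 0 x = f x) \<and>
     (\<forall>n::nat. \<forall>x\<in>S. (D n has_real_derivative D (Suc n) x) (at x within S)))"

definition slit_plane :: "complex set" where
  "slit_plane = - {z. Re z = 0 \<and> pi / 2 \<le> \<bar>Im z\<bar>}"

text \<open>
  The lemma \<open>log_cosh_unique\<close> below shows that the conditions determine
  \<open>log_cosh\<close> on \<open>slit_plane\<close>; its values elsewhere are unspecified.
\<close>

definition log_cosh :: "complex \<Rightarrow> complex" where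
  "log_cosh = (SOME L. L holomorphic_on slit_plane \<and> L 0 = 0 \<and>
     (\<forall>z\<in>slit_plane. exp (L z) = cosh z))"

definition hfun :: "complex \<Rightarrow> complex \<Rightarrow> complex" where
  "hfun \<beta> u = u\<^sup>2 / (2 * \<beta>) - log_cosh u"

definition crit_points :: "real \<Rightarrow> complex \<Rightarrow> complex set" where
  "crit_points c0 \<beta> = {u. cmod u \<le> 10 * sqrt c0 \<and> deriv (hfun \<beta>) u = 0}"

lemma zero_in_slit_plane [simp]: "0 \<in> slit_plane"
  using pi_gt_zero by (simp add: slit_plane_def not_le)

lemma uminus_in_slit_plane [simp]: "- z \<in> slit_plane \<longleftrightarrow> z \<in> slit_plane"
  by (simp add: slit_plane_def)

lemma open_slit_plane: "open slit_plane"
proof -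
  have "closed ({z. Re z = 0} \<inter> {z. pi / 2 \<le> \<bar>Im z\<bar>})"
    by (intro closed_Int closed_Collect_eq closed_Collect_le continuous_intros)
  then show ?thesis
    unfolding slit_plane_def Collect_conj_eq by (rule open_Compl)
qed

lemma starlike_slit_plane: "starlike slit_plane"
  unfolding starlike_def
proof (intro bexI ballI)
  fix x assume x: "x \<in> slit_plane"
  show "closed_segment 0 x \<subseteq> slit_plane"
  proof
    fix y assume "y \<in> closed_segment 0 x"
    then obtain t where t: "0 \<le> t" "t \<le> 1" "y = t *\<^sub>R x"
      by (auto simp: in_segment)
    have "\<bar>t * Im x\<bar> \<le> \<bar>Im x\<bar>"
      using t by (simp add: abs_mult mult_left_le_one_le)
    then show "y \<in> slit_plane"
      using x t pi_gt_zero by (cases "t = 0") (auto simp: slit_plane_def simp del: pi_gt_zero)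
  qed
qed simp

lemma cosh_nonzero_slit_plane:
  assumes "z \<in> slit_plane"
  shows "cosh z \<noteq> 0"
proof
  assume "cosh z = 0"
  then have "exp (2 * z) = exp (\<i> * pi)"
    by (simp add: cosh_zero_iff exp_double)
  then obtain n :: int where n: "2 * z = \<i> * pi + of_int (2 * n) * pi * \<i>"
    unfolding exp_eq by blast
  from arg_cong[OF n, of Re] have re: "Re z = 0"
    by simp
  from arg_cong[OF n, of Im] have im: "Im z = (2 * real_of_int n + 1) * (pi / 2)"
    by (simp add: field_simps)
  have "\<bar>2 * n + 1\<bar> \<ge> 1"
    by presburger
  then have "\<bar>2 * real_of_int n + 1\<bar> \<ge> 1"
    by linarith
  then have "\<bar>Im z\<bar> \<ge> 1 * (pi / 2)"
    unfolding im abs_mult by (intro mult_mono) auto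
  with re assms show False
    by (simp add: slit_plane_def)
qed

lemma log_branch_derivative:
  assumes N: "N holomorphic_on slit_plane" "\<And>z. z \<in> slit_plane \<Longrightarrow> exp (N z) = cosh z"
    and w: "w \<in> slit_plane"
  shows "(N has_field_derivative tanh w) (at w)"
proof -
  have d: "(N has_field_derivative deriv N w) (at w)"
    using N(1) open_slit_plane w by (rule holomorphic_derivI)
  have "((\<lambda>z. exp (N z)) has_field_derivative exp (N w) * deriv N w) (at w)"
    using d by (rule DERIV_fun_exp)
  moreover have "((\<lambda>z. exp (N z)) has_field_derivative sinh w) (at w)"
    by (rule has_field_derivative_transform_within_open
          [of cosh _ _ slit_plane]) (auto simp: N(2) w open_slit_plane intro!: derivative_eq_intros)
  ultimately have "cosh w * deriv N w = sinh w"
    using DERIV_unique N(2)[OF w] by metis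
  then have "deriv N w = tanh w"
    using cosh_nonzero_slit_plane[OF w] by (simp add: tanh_def field_simps)
  with d show ?thesis by simp
qed

lemma log_branch_unique:
  assumes L: "L holomorphic_on slit_plane" "L 0 = 0" "\<And>z. z \<in> slit_plane \<Longrightarrow> exp (L z) = cosh z"
    and M: "M holomorphic_on slit_plane" "M 0 = 0" "\<And>z. z \<in> slit_plane \<Longrightarrow> exp (M z) = cosh z"
    and z: "z \<in> slit_plane"
  shows "L z = M z"
proof -
  have "(\<lambda>w. L w - M w) constant_on slit_plane"
    using log_branch_derivative[OF L(1,3)] log_branch_derivative[OF M(1,3)]
    by (intro has_field_derivative_0_imp_constant_on open_slit_plane
          starlike_imp_connected starlike_slit_plane) (auto intro!: derivative_eq_intros)
  then have "L z - M z = L 0 - M 0"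
    using z unfolding constant_on_def by (metis zero_in_slit_plane)
  then show ?thesis by (simp add: L(2) M(2))
qed

lemma log_cosh_exists:
  "\<exists>L. L holomorphic_on slit_plane \<and> L 0 = 0 \<and> (\<forall>z\<in>slit_plane. exp (L z) = cosh z)"
proof -
  have "(cosh :: complex \<Rightarrow> complex) holomorphic_on slit_plane"
    unfolding cosh_field_def by (intro holomorphic_intros) auto
  from contractible_imp_holomorphic_log[OF this starlike_imp_contractible[OF starlike_slit_plane]
      cosh_nonzero_slit_plane]
  obtain g where g: "g holomorphic_on slit_plane" "\<And>z. z \<in> slit_plane \<Longrightarrow> cosh z = exp (g z)"
    by blast
  have "exp (g 0) = 1"
    using g(2)[of 0] by simp
  then show ?thesis
    using g by (intro exI[of _ "\<lambda>z. g z - g 0"]) (auto intro!: holomorphic_intros simp: exp_diff)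
qed

lemma log_cosh_holomorphic: "log_cosh holomorphic_on slit_plane"
  and log_cosh_0 [simp]: "log_cosh 0 = 0"
  and exp_log_cosh: "z \<in> slit_plane \<Longrightarrow> exp (log_cosh z) = cosh z"
  using someI_ex[OF log_cosh_exists, folded log_cosh_def] by blast+

lemma log_cosh_unique:
  assumes "L holomorphic_on slit_plane" "L 0 = 0" "\<And>z. z \<in> slit_plane \<Longrightarrow> exp (L z) = cosh z"
    and "z \<in> slit_plane"
  shows "L z = log_cosh z"
  using assms log_branch_unique log_cosh_holomorphic log_cosh_0 exp_log_cosh by metis

lemma hfun_even:
  assumes "u \<in> slit_plane"
  shows "hfun \<beta> (- u) = hfun \<beta> u"
proof -
  have "(\<lambda>z. log_cosh (- z)) holomorphic_on slit_plane"
    by (rule holomorphic_on_compose_gen[OF _ log_cosh_holomorphic, of uminus slit_plane, unfolded o_def])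
      (auto intro!: holomorphic_intros)
  then have "log_cosh (- u) = log_cosh u"
    using assms by (intro log_cosh_unique[of "\<lambda>z. log_cosh (- z)"]) (auto simp: exp_log_cosh)
  then show ?thesis by (simp add: hfun_def)
qed

lemma deriv_hfun:
  assumes "\<beta> \<noteq> 0" "u \<in> slit_plane"
  shows "deriv (hfun \<beta>) u = u / \<beta> - tanh u"
proof -
  have "(hfun \<beta> has_field_derivative u / \<beta> - tanh u) (at u)"
    unfolding hfun_def[abs_def]
    using assms log_branch_derivative[OF log_cosh_holomorphic exp_log_cosh assms(2)]
    by (auto intro!: derivative_eq_intros)
  then show ?thesis by (rule DERIV_imp_deriv)
qed

lemma crit_points_card_3:
  assumes "c0 > 0" "cball 0 (10 * sqrt c0) \<subseteq> slit_plane" "\<beta> \<noteq> 0" "card (crit_points c0 \<beta>) = 3"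
  shows "\<exists>u. crit_points c0 \<beta> = {0, u, - u}"
proof -
  let ?Z = "crit_points c0 \<beta>"
  have Z: "z \<in> ?Z \<longleftrightarrow> cmod z \<le> 10 * sqrt c0 \<and> z / \<beta> - tanh z = 0" for z
    using assms(2) deriv_hfun[OF assms(3), of z] by (auto simp: crit_points_def subset_iff)
  have fin: "finite ?Z"
    using assms(4) by (intro card_ge_0_finite) simp
  have 0: "0 \<in> ?Z"
    using assms(1) by (simp add: Z)
  have "card {0 :: complex} \<noteq> card ?Z"
    unfolding assms(4) by simp
  then have "?Z \<noteq> {0}"
    by metis
  with 0 obtain u where u: "u \<in> ?Z" "u \<noteq> 0"
    by blast
  have "- u \<in> ?Z"
    using u(1) by (simp add: Z)
  moreover have "card {0, u, - u} = 3"
    using u(2) by (simp add: card_insert_if)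
  ultimately have "{0, u, - u} = ?Z"
    using 0 u(1) fin assms(4) by (intro card_subset_eq) simp_all
  then show ?thesis by (intro exI) (rule sym)
qed

end

theory Submission
  imports Defs
begin

text \<open>
  The nonzero zeros of \<open>h\<^sub>\<beta>'\<close> solve \<open>\<beta> = u coth u\<close>. The right-hand side is an analytic function
  \<open>G\<close> of \<open>s = u\<^sup>2\<close> with \<open>G 0 = 1\<close> and \<open>G' 0 = 1 / 3\<close>, so near \<open>\<beta> = 1\<close> it can be inverted: \<open>s\<close> is
  an analytic function of \<open>w = \<beta> - 1\<close>, even though \<open>u\<^sub>\<beta>\<close> itself branches at \<open>w = 0\<close>.
  Since \<open>h\<^sub>\<beta>\<close> is even, the critical value \<open>h\<^sub>\<beta> (\<plusminus>u\<^sub>\<beta>)\<close> is an analytic function \<open>F w\<close>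
  with real Taylor coefficients. As \<open>u\<^sub>\<beta>\<close> is a critical point, differentiating in \<open>w\<close> leaves only
  the explicit dependence on \<open>\<beta>\<close>, namely \<open>F' w = - s w / (2 (1 + w)\<^sup>2)\<close>; hence
  \<open>F w = - (3 / 4) w\<^sup>2 + O(w\<^sup>3)\<close> (\<open>critical_value_function\<close>).

  It remains to find the sign of \<open>Re F\<close> near such a double zero (\<open>real_part_sign_curve\<close>).
  Write \<open>F = - (3 / 4) \<psi>\<^sup>2\<close>, where \<open>\<psi> w = w + O(w\<^sup>2)\<close> again has real coefficients, and put
  \<open>P x y = Re ((1 + \<i>) \<psi> (x + \<i> y)) = Re \<psi> - Im \<psi>\<close>. Complex conjugation turns \<open>Re \<psi> + Im \<psi>\<close> into
  \<open>P x (- y)\<close>, so \<open>Re (\<psi>\<^sup>2) = P x y * P x (- y)\<close>. Since \<open>\<psi>'\<close> is close to \<open>1\<close>, \<open>P x\<close> is strictly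
  decreasing; if \<open>R\<^sub>0 x\<close> denotes its zero, the product is positive, zero or negative
  according as \<open>\<bar>y\<bar>\<close> is less than, equal to or greater than \<open>\<bar>R\<^sub>0 x\<bar>\<close>.

  The zero set of \<open>P\<close> is the curve \<open>\<psi> = (1 + \<i>) t\<close> with \<open>t\<close> real, that is, \<open>\<phi> ((1 + \<i>) t)\<close> for
  \<open>\<phi> = \<psi>\<inverse>\<close>. Because \<open>\<phi>\<close> has real coefficients, the real part of this point is the value at \<open>t\<close> of
  the holomorphic function \<open>A t = (\<phi> ((1 + \<i>) t) + \<phi> ((1 - \<i>) t)) / 2\<close>, whose inverse \<open>\<tau>\<close> is
  again holomorphic. So \<open>R\<^sub>0 x = Im (\<phi> ((1 + \<i>) \<tau> x))\<close> is real analytic and tangent to the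
  identity at \<open>0\<close>.
\<close>

section \<open>Holomorphic functions with real Taylor coefficients\<close>

text \<open>
  A holomorphic function on the disc of radius \<open>\<rho>\<close> whose Taylor coefficients at \<open>0\<close> are real,
  expressed as invariance under complex conjugation.
\<close>

definition real_holomorphic :: "real \<Rightarrow> (complex \<Rightarrow> complex) \<Rightarrow> bool" where
  "real_holomorphic \<rho> f \<longleftrightarrow>
     f holomorphic_on ball 0 \<rho> \<and> (\<forall>z\<in>ball 0 \<rho>. f (cnj z) = cnj (f z))"

lemma real_holomorphicI:
  assumes "f holomorphic_on ball 0 \<rho>" "\<And>z. cmod z < \<rho> \<Longrightarrow> f (cnj z) = cnj (f z)"
  shows "real_holomorphic \<rho> f"
  using assms by (simp add: real_holomorphic_def)

lemma real_holomorphicD: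
  assumes "real_holomorphic \<rho> f"
  shows "f holomorphic_on ball 0 \<rho>" "\<And>z. cmod z < \<rho> \<Longrightarrow> f (cnj z) = cnj (f z)"
  using assms by (simp_all add: real_holomorphic_def)

lemma real_holomorphic_DERIV:
  assumes "real_holomorphic \<rho> f" "cmod z < \<rho>"
  shows "(f has_field_derivative deriv f z) (at z)"
  using assms by (intro holomorphic_derivI[of f "ball 0 \<rho>"]) (auto simp: real_holomorphic_def)

lemma real_holomorphic_subset:
  assumes "real_holomorphic \<rho> f" "\<rho>' \<le> \<rho>"
  shows "real_holomorphic \<rho>' f"
  using assms holomorphic_on_subset[of f "ball 0 \<rho>" "ball 0 \<rho>'"]
  by (simp add: real_holomorphic_def subset_ball)

lemma real_holomorphic_compose:
  assumes "real_holomorphic \<rho> f" "real_holomorphic \<delta> g" "\<And>z. cmod z < \<delta> \<Longrightarrow> cmod (g z) < \<rho>"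
  shows "real_holomorphic \<delta> (\<lambda>z. f (g z))"
proof (rule real_holomorphicI)
  have "g ` ball 0 \<delta> \<subseteq> ball 0 \<rho>"
    using assms(3) by auto
  then show "(\<lambda>z. f (g z)) holomorphic_on ball 0 \<delta>"
    using holomorphic_on_compose_gen[of g "ball 0 \<delta>" f "ball 0 \<rho>"] assms(1,2)
    by (simp add: real_holomorphic_def o_def)
qed (use assms in \<open>simp add: real_holomorphic_def\<close>)

lemma real_holomorphic_real:
  assumes "real_holomorphic \<rho> f" "\<bar>x\<bar> < \<rho>"
  shows "Im (f (of_real x)) = 0"
proof -
  have "f (cnj (of_real x)) = cnj (f (of_real x))"
    using assms by (intro real_holomorphicD(2)[OF assms(1)]) simp
  then show ?thesis
    by (simp add: complex_eq_iff)
qed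

lemma real_holomorphic_inverse:
  assumes f: "real_holomorphic \<rho> f" and "\<rho> > 0" "f 0 = 0" "deriv f 0 \<noteq> 0" "\<eta> > 0"
  obtains \<delta> g where "\<delta> > 0" "real_holomorphic \<delta> g" "g 0 = 0"
    "\<And>z. cmod z < \<delta> \<Longrightarrow> cmod (g z) < \<rho>" "\<And>z. cmod z < \<delta> \<Longrightarrow> cmod (g z) < \<eta>"
    "\<And>z. cmod z < \<delta> \<Longrightarrow> f (g z) = z"
    "\<And>z. cmod z < \<delta> \<Longrightarrow> deriv f (g z) * deriv g z = 1"
proof -
  define S where "S = ball (0::complex) (min \<eta> \<rho>)"
  have S: "f holomorphic_on S" "0 \<in> S" "open S"
    using holomorphic_on_subset[OF real_holomorphicD(1)[OF f], of S] \<open>\<rho> > 0\<close> \<open>\<eta> > 0\<close>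
    by (simp_all add: S_def subset_ball)
  obtain r where r: "r > 0" "ball 0 r \<subseteq> S" "inj_on f (ball 0 r)"
    using has_complex_derivative_locally_injective[OF S assms(4)] .
  have fr: "f holomorphic_on ball 0 r"
    using S(1) r(2) holomorphic_on_subset by blast
  obtain g where g: "g holomorphic_on (f ` ball 0 r)"
      "\<And>z. z \<in> ball 0 r \<Longrightarrow> deriv f z * deriv g (f z) = 1" "\<And>z. z \<in> ball 0 r \<Longrightarrow> g (f z) = z"
    using holomorphic_has_inverse[OF fr open_ball r(3)] by metis
  have "open (f ` ball 0 r)"
    by (rule open_mapping_thm3[OF fr open_ball r(3)])
  moreover have "0 \<in> f ` ball 0 r"
    using r(1) assms(3) by (metis centre_in_ball imageI)
  ultimately obtain \<delta> where \<delta>: "\<delta> > 0" "ball 0 \<delta> \<subseteq> f ` ball 0 r"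
    by (meson open_contains_ball)
  have pre: "\<exists>x. cmod x < min \<eta> \<rho> \<and> x \<in> ball 0 r \<and> f x = z \<and> g z = x" if "cmod z < \<delta>" for z
  proof -
    have "z \<in> f ` ball 0 r"
      using that \<delta>(2) by auto
    then show ?thesis
      using g(3) r(2) by (auto simp: S_def)
  qed
  show ?thesis
  proof (rule that[OF \<delta>(1)])
    show "real_holomorphic \<delta> g"
    proof (rule real_holomorphicI)
      show "g holomorphic_on ball 0 \<delta>"
        using g(1) \<delta>(2) by (rule holomorphic_on_subset)
      fix z assume "cmod z < \<delta>"
      with pre obtain x where x: "cmod x < min \<eta> \<rho>" "x \<in> ball 0 r" "f x = z" "g z = x"
        by blast
      have "f (cnj x) = cnj z"
        using real_holomorphicD(2)[OF f, of x] x by simp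
      moreover have "cnj x \<in> ball 0 r"
        using x by simp
      ultimately show "g (cnj z) = cnj (g z)"
        using g(3) x(4) by metis
    qed
    show "g 0 = 0"
      using g(3)[of 0] r(1) assms(3) by simp
    fix z assume "cmod z < \<delta>"
    with pre obtain x where x: "cmod x < min \<eta> \<rho>" "x \<in> ball 0 r" "f x = z" "g z = x"
      by blast
    then show "cmod (g z) < \<rho>" "cmod (g z) < \<eta>" "f (g z) = z" "deriv f (g z) * deriv g z = 1"
      using g(2)[of x] by auto
  qed
qed

section \<open>Second-order expansions and smoothness\<close>

lemma second_order_factor:
  assumes f: "f holomorphic_on ball 0 \<rho>" and "\<rho> > 0"
  obtains q where "q holomorphic_on ball 0 \<rho>"
    "\<And>z. cmod z < \<rho> \<Longrightarrow> f z = f 0 + deriv f 0 * z + z\<^sup>2 * q z"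
    "q 0 = deriv (deriv f) 0 / 2"
proof -
  let ?B = "ball (0::complex) \<rho>"
  define p where "p = (\<lambda>z. if z = 0 then deriv f 0 else (f z - f 0) / (z - 0))"
  define q where "q = (\<lambda>z. if z = 0 then deriv p 0 else (p z - p 0) / (z - 0))"
  have p: "p holomorphic_on ?B"
    unfolding p_def by (rule pole_lemma_open[OF f open_ball])
  have q: "q holomorphic_on ?B"
    unfolding q_def by (rule pole_lemma_open[OF p open_ball])
  have eq: "f z = f 0 + deriv f 0 * z + z\<^sup>2 * q z" for z
    by (simp add: q_def p_def field_simps power2_eq_square)
  have Dq: "(q has_field_derivative deriv q z) (at z)" if "z \<in> ?B" for z
    using q that by (intro holomorphic_derivI[of q ?B]) auto
  have D: "deriv f z = deriv f 0 + (2 * z * q z + z\<^sup>2 * deriv q z)" if "z \<in> ?B" for z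
  proof -
    have "((\<lambda>z. f 0 + deriv f 0 * z + z\<^sup>2 * q z) has_field_derivative
           deriv f 0 + (2 * z * q z + z\<^sup>2 * deriv q z)) (at z)"
      by (rule derivative_eq_intros Dq[OF that] refl | simp)+
    then show ?thesis
      using eq by (metis (no_types, lifting) DERIV_imp_deriv ext)
  qed
  have "(deriv q has_field_derivative deriv (deriv q) 0) (at 0)"
    using \<open>\<rho> > 0\<close> by (intro holomorphic_derivI[of _ ?B] holomorphic_deriv q) auto
  moreover have "(q has_field_derivative deriv q 0) (at 0)"
    using \<open>\<rho> > 0\<close> by (intro Dq) simp
  ultimately have "((\<lambda>z. deriv f 0 + (2 * z * q z + z\<^sup>2 * deriv q z)) has_field_derivative 2 * q 0) (at 0)"
    by (auto intro!: derivative_eq_intros)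
  then have "(deriv f has_field_derivative 2 * q 0) (at 0)"
    by (rule has_field_derivative_transform_within_open[OF _ open_ball[of 0 \<rho>] _ D[symmetric]])
      (use \<open>\<rho> > 0\<close> in auto)
  then show ?thesis
    using that[OF q eq] by (simp add: DERIV_imp_deriv)
qed

lemma smooth_on_Im:
  assumes f: "f holomorphic_on ball 0 \<rho>" and S: "\<And>x. x \<in> S \<Longrightarrow> \<bar>x\<bar> < \<rho>"
  shows "smooth_on (\<lambda>x. Im (f (of_real x))) S"
  unfolding smooth_on_def
proof (intro exI[of _ "\<lambda>n x. Im ((deriv ^^ n) f (of_real x))"] conjI ballI allI)
  fix n x assume "x \<in> S"
  have "(deriv ^^ n) f holomorphic_on ball 0 \<rho>"
    by (intro holomorphic_higher_deriv f open_ball)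
  then have "((deriv ^^ n) f has_field_derivative deriv ((deriv ^^ n) f) (of_real x)) (at (of_real x))"
    using S[OF \<open>x \<in> S\<close>] by (intro holomorphic_derivI[of _ "ball 0 \<rho>"]) auto
  from has_vector_derivative_real_field[OF this]
  show "((\<lambda>x. Im ((deriv ^^ n) f (of_real x))) has_real_derivative
          Im ((deriv ^^ Suc n) f (of_real x))) (at x within S)"
    by (simp add: has_vector_derivative_complex_iff)
qed simp

lemma linear_approx:
  assumes f: "f holomorphic_on ball 0 \<rho>" and "\<rho> > 0"
  obtains c C where "c > 0" "c < \<rho>" "C > 0"
    "\<And>z. cmod z \<le> c \<Longrightarrow> cmod (f z - (f 0 + deriv f 0 * z)) \<le> C * cmod z ^ 2"
proof -
  obtain q where q: "q holomorphic_on ball 0 \<rho>"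
    "\<And>z. cmod z < \<rho> \<Longrightarrow> f z = f 0 + deriv f 0 * z + z\<^sup>2 * q z"
    using second_order_factor[OF assms] by metis
  define c where "c = \<rho> / 2"
  have c: "c > 0" "c < \<rho>"
    using \<open>\<rho> > 0\<close> by (auto simp: c_def)
  have "continuous_on (cball 0 c) q"
    using c by (intro holomorphic_on_imp_continuous_on holomorphic_on_subset[OF q(1)]) auto
  then have "bounded (q ` cball 0 c)"
    by (intro compact_imp_bounded compact_continuous_image) auto
  then obtain C where C: "C > 0" "\<And>z. cmod z \<le> c \<Longrightarrow> cmod (q z) \<le> C"
    by (auto simp: bounded_pos)
  show ?thesis
  proof (rule that[OF c C(1)])
    fix z :: complex assume z: "cmod z \<le> c"
    then have "cmod (f z - (f 0 + deriv f 0 * z)) = cmod (q z) * cmod z ^ 2"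
      using q(2)[of z] c by (simp add: norm_mult norm_power)
    also have "\<dots> \<le> C * cmod z ^ 2"
      using C(2)[OF z] by (intro mult_right_mono) auto
    finally show "cmod (f z - (f 0 + deriv f 0 * z)) \<le> C * cmod z ^ 2" .
  qed
qed

lemma small_near_zero:
  assumes "continuous_on (ball 0 \<rho>) f" "(f::complex \<Rightarrow> complex) 0 = a" "\<rho> > 0" "e > 0"
  obtains \<delta> where "\<delta> > 0" "\<delta> \<le> \<rho>" "\<And>z. cmod z < \<delta> \<Longrightarrow> cmod (f z - a) < e"
proof -
  have "isCont f 0"
    using assms by (auto simp: continuous_on_eq_continuous_at)
  then obtain d where "d > 0" "\<And>z. dist z 0 < d \<Longrightarrow> dist (f z) (f 0) < e"
    using \<open>e > 0\<close> by (auto simp: continuous_at_eps_delta)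
  then show ?thesis
    using assms by (intro that[of "min d \<rho>"]) (auto simp: dist_norm)
qed

text \<open>
  A double zero with negative second derivative makes \<open>F\<close> a negative multiple of the square of a
  local coordinate; this coordinate inherits the real Taylor coefficients.
\<close>

lemma real_square_root:
  assumes F: "real_holomorphic \<rho> F" and "\<rho> > 0" "F 0 = 0" "deriv F 0 = 0"
    and a: "deriv (deriv F) 0 = - 2 * of_real a" "a > 0"
  obtains \<sigma> \<psi> where "\<sigma> > 0" "\<sigma> \<le> \<rho>" "real_holomorphic \<sigma> \<psi>" "\<psi> 0 = 0" "deriv \<psi> 0 = 1"
    "\<And>z. cmod z < \<sigma> \<Longrightarrow> F z = - of_real a * (\<psi> z)\<^sup>2"
    "\<And>z. cmod z < \<sigma> \<Longrightarrow> cmod (deriv \<psi> z - 1) < 1 / 2"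
proof -
  obtain q where q: "q holomorphic_on ball 0 \<rho>"
    "\<And>z. cmod z < \<rho> \<Longrightarrow> F z = z\<^sup>2 * q z" "q 0 = - of_real a"
    using second_order_factor[OF real_holomorphicD(1)[OF F] \<open>\<rho> > 0\<close>] assms by auto
  define p where "p z = q z / (- of_real a)" for z
  have p: "p holomorphic_on ball 0 \<rho>" "p 0 = 1"
    using q \<open>a > 0\<close> unfolding p_def by (auto intro!: holomorphic_intros)
  have Fp: "F z = - of_real a * (z\<^sup>2 * p z)" if "cmod z < \<rho>" for z
    using q(2)[OF that] \<open>a > 0\<close> by (simp add: p_def)
  have p_cnj: "p (cnj z) = cnj (p z)" if "cmod z < \<rho>" for z
  proof (cases "z = 0")
    case False
    have "F (cnj z) = cnj (F z)"
      using real_holomorphicD(2)[OF F that] .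
    then show ?thesis
      using Fp[of z] Fp[of "cnj z"] that False \<open>a > 0\<close> by simp
  qed (simp add: p(2))
  obtain \<sigma>1 where \<sigma>1: "\<sigma>1 > 0" "\<sigma>1 \<le> \<rho>" "\<And>z. cmod z < \<sigma>1 \<Longrightarrow> cmod (p z - 1) < 1"
    using small_near_zero[OF holomorphic_on_imp_continuous_on[OF p(1)] p(2) \<open>\<rho> > 0\<close>, of 1] by auto
  have np: "p z \<notin> \<real>\<^sub>\<le>\<^sub>0" if "cmod z < \<sigma>1" for z
  proof -
    have "\<bar>Re (p z - 1)\<bar> < 1"
      using \<sigma>1(3)[OF that] abs_Re_le_cmod[of "p z - 1"] by linarith
    then show ?thesis
      by (auto simp: complex_nonpos_Reals_iff)
  qed
  define \<psi> where "\<psi> z = z * csqrt (p z)" for z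
  have p1: "p holomorphic_on ball 0 \<sigma>1"
    using holomorphic_on_subset[OF p(1)] \<sigma>1(2) by (simp add: subset_ball)
  have hol: "(\<lambda>z. csqrt (p z)) holomorphic_on ball 0 \<sigma>1"
    using np by (intro holomorphic_intros p1) auto
  have \<psi>: "real_holomorphic \<sigma>1 \<psi>"
  proof (rule real_holomorphicI)
    show "\<psi> holomorphic_on ball 0 \<sigma>1"
      unfolding \<psi>_def by (intro holomorphic_intros hol)
    show "\<psi> (cnj z) = cnj (\<psi> z)" if "cmod z < \<sigma>1" for z
      using that \<sigma>1(2) by (simp add: \<psi>_def p_cnj cnj_csqrt np)
  qed
  have "((\<lambda>z. csqrt (p z)) has_field_derivative deriv (\<lambda>z. csqrt (p z)) 0) (at 0)"
    using \<sigma>1(1) by (intro holomorphic_derivI[OF hol]) auto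
  then have "(\<psi> has_field_derivative 1) (at 0)"
    unfolding \<psi>_def by (intro DERIV_cong[OF DERIV_mult[OF DERIV_ident]]) (auto simp: p(2))
  then have d1: "deriv \<psi> 0 = 1"
    by (rule DERIV_imp_deriv)
  have "continuous_on (ball 0 \<sigma>1) (deriv \<psi>)"
    by (intro holomorphic_on_imp_continuous_on holomorphic_deriv real_holomorphicD(1)[OF \<psi>]) auto
  then obtain \<sigma> where \<sigma>: "\<sigma> > 0" "\<sigma> \<le> \<sigma>1" "\<And>z. cmod z < \<sigma> \<Longrightarrow> cmod (deriv \<psi> z - 1) < 1 / 2"
    using small_near_zero[of \<sigma>1 "deriv \<psi>" 1 "1/2"] d1 \<sigma>1(1) by auto
  show ?thesis
  proof (rule that[OF \<sigma>(1)])
    show "\<sigma> \<le> \<rho>" using \<sigma> \<sigma>1 by simp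
    show "real_holomorphic \<sigma> \<psi>" using \<psi> \<sigma>(2) by (rule real_holomorphic_subset)
    show "F z = - of_real a * (\<psi> z)\<^sup>2" if "cmod z < \<sigma>" for z
      using Fp[of z] that \<sigma>(2) \<sigma>1(2) by (simp add: \<psi>_def power_mult_distrib)
  qed (use d1 \<sigma>(3) in \<open>auto simp: \<psi>_def\<close>)
qed

section \<open>The sign of the real part near a double zero\<close>

lemma real_part_sign_curve:
  assumes F: "real_holomorphic \<rho> F" and "\<rho> > 0" "F 0 = 0" "deriv F 0 = 0"
    and a: "deriv (deriv F) 0 = - 2 * of_real a" "a > 0"
  obtains c C r :: real and R0 :: "real \<Rightarrow> real" where "c > 0" "C > 0" "r > 0"
    "smooth_on R0 {-c..c}" "\<And>x. \<bar>x\<bar> \<le> c \<Longrightarrow> \<bar>R0 x - x\<bar> \<le> C * x\<^sup>2"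
    "\<And>x y. \<bar>x\<bar> \<le> c \<Longrightarrow> cmod (Complex x y) < r \<Longrightarrow>
       sgn (Re (F (Complex x y))) = sgn (\<bar>y\<bar> - \<bar>R0 x\<bar>)"
proof -
  obtain r \<psi> where r: "r > 0" "r \<le> \<rho>" and \<psi>: "real_holomorphic r \<psi>" "\<psi> 0 = 0" "deriv \<psi> 0 = 1"
      and F_\<psi>: "\<And>z. cmod z < r \<Longrightarrow> F z = - of_real a * (\<psi> z)\<^sup>2"
      and \<psi>': "\<And>z. cmod z < r \<Longrightarrow> cmod (deriv \<psi> z - 1) < 1 / 2"
    using real_square_root[OF assms] by metis
  define P where "P x y = Re ((1 + \<i>) * \<psi> (Complex x y))" for x y
  have cmod_1i: "cmod (1 + \<i>) < 2" "cmod (1 - \<i>) < 2"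
    by (simp_all add: cmod_def real_less_lsqrt)

  have Re_F: "Re (F (Complex x y)) = - a * (P x y * P x (- y))" if "cmod (Complex x y) < r" for x y
  proof -
    have "\<psi> (Complex x (- y)) = cnj (\<psi> (Complex x y))"
      using real_holomorphicD(2)[OF \<psi>(1) that] by (simp add: complex_cnj)
    then show ?thesis
      using F_\<psi>[OF that] by (simp add: P_def power2_eq_square algebra_simps)
  qed

  have P_less: "P x y2 < P x y1"
    if "cmod (Complex x y1) < r" "cmod (Complex x y2) < r" "y1 < y2" for x y1 y2
  proof -
    define z1 z2 where "z1 = Complex x y1" and "z2 = Complex x y2"
    \<comment> \<open>The linear part of \<open>\<psi>\<close> contributes \<open>y1 - y2\<close>; the rest is Lipschitz with constant \<open>1 / 2\<close>,
        and \<open>cmod (1 + \<i>) < 2\<close>.\<close>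
    have D: "((\<lambda>z. \<psi> z - z) has_field_derivative deriv \<psi> z - 1) (at z within ball 0 r)"
      if "z \<in> ball 0 r" for z
      using that real_holomorphic_DERIV[OF \<psi>(1), of z]
      by (auto intro!: derivative_eq_intros intro: has_field_derivative_at_within)
    have "cmod ((\<psi> z2 - z2) - (\<psi> z1 - z1)) \<le> 1 / 2 * cmod (z2 - z1)"
      by (rule field_differentiable_bound[OF convex_ball D])
        (use that \<psi>' in \<open>auto simp: z1_def z2_def intro: less_imp_le\<close>)
    also have "z2 - z1 = \<i> * of_real (y2 - y1)"
      by (simp add: z1_def z2_def complex_eq_iff)
    finally have "cmod ((\<psi> z2 - z2) - (\<psi> z1 - z1)) \<le> 1 / 2 * (y2 - y1)"
      using that(3) by (simp only: norm_mult norm_ii norm_of_real)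
    then have "cmod ((1 + \<i>) * ((\<psi> z2 - z2) - (\<psi> z1 - z1))) \<le> cmod (1 + \<i>) * (1 / 2 * (y2 - y1))"
      unfolding norm_mult by (intro mult_left_mono) auto
    also have "\<dots> < 2 * (1 / 2 * (y2 - y1))"
      using cmod_1i that(3) by (intro mult_strict_right_mono) auto
    finally have "Re ((1 + \<i>) * ((\<psi> z2 - z2) - (\<psi> z1 - z1))) < y2 - y1"
      using complex_Re_le_cmod[of "(1 + \<i>) * ((\<psi> z2 - z2) - (\<psi> z1 - z1))"] by simp
    then show ?thesis
      by (simp add: P_def z1_def z2_def algebra_simps)
  qed

  obtain \<delta>1 \<phi> where \<delta>1: "\<delta>1 > 0" and \<phi>: "real_holomorphic \<delta>1 \<phi>" "\<phi> 0 = 0"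
      "\<And>z. cmod z < \<delta>1 \<Longrightarrow> cmod (\<phi> z) < r" "\<And>z. cmod z < \<delta>1 \<Longrightarrow> \<psi> (\<phi> z) = z"
      "\<And>z. cmod z < \<delta>1 \<Longrightarrow> deriv \<psi> (\<phi> z) * deriv \<phi> z = 1"
    using real_holomorphic_inverse[OF \<psi>(1) r(1) \<psi>(2) _ zero_less_one] \<psi>(3) zero_neq_one by metis
  have \<phi>'0: "deriv \<phi> 0 = 1"
    using \<phi>(5)[of 0] \<delta>1 \<phi>(2) \<psi>(3) by simp
  define \<delta>2 where "\<delta>2 = \<delta>1 / 2"
  have \<delta>2: "\<delta>2 > 0"
    using \<delta>1 by (simp add: \<delta>2_def)
  have in1: "cmod ((1 + \<i>) * t) < \<delta>1" "cmod ((1 - \<i>) * t) < \<delta>1" if "cmod t < \<delta>2" for t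
  proof -
    have "cmod s * cmod t \<le> 2 * cmod t" if "cmod s < 2" for s
      using that by (intro mult_right_mono) auto
    then have "cmod (s * t) < \<delta>1" if "cmod s < 2" for s
      using that \<open>cmod t < \<delta>2\<close> by (force simp: \<delta>2_def norm_mult)
    then show "cmod ((1 + \<i>) * t) < \<delta>1" "cmod ((1 - \<i>) * t) < \<delta>1"
      using cmod_1i by blast+
  qed
  \<comment> \<open>For real \<open>t\<close> the two summands are complex conjugates, so \<open>A t = Re (\<phi> ((1 + \<i>) * t))\<close>.\<close>
  define A where "A t = (\<phi> ((1 + \<i>) * t) + \<phi> ((1 - \<i>) * t)) / 2" for t
  have hol\<phi>: "(\<lambda>t. \<phi> (s * t)) holomorphic_on ball 0 \<delta>2" if "s = 1 + \<i> \<or> s = 1 - \<i>" for s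
  proof -
    have "(\<lambda>t. s * t) ` ball 0 \<delta>2 \<subseteq> ball 0 \<delta>1"
      using in1 that by auto
    moreover have "(\<lambda>t. s * t) holomorphic_on ball 0 \<delta>2"
      by (intro holomorphic_intros)
    ultimately show ?thesis
      using holomorphic_on_compose_gen[OF _ real_holomorphicD(1)[OF \<phi>(1)]] by (simp add: o_def)
  qed
  have A: "real_holomorphic \<delta>2 A"
  proof (rule real_holomorphicI)
    show "A holomorphic_on ball 0 \<delta>2"
      unfolding A_def by (intro holomorphic_intros hol\<phi>) auto
    fix t assume t: "cmod t < \<delta>2"
    show "A (cnj t) = cnj (A t)"
      using real_holomorphicD(2)[OF \<phi>(1) in1(1)[OF t]] real_holomorphicD(2)[OF \<phi>(1) in1(2)[OF t]]
      by (simp add: A_def)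
  qed
  have D\<phi>: "((\<lambda>t. \<phi> (s * t)) has_field_derivative s) (at 0)" for s
  proof -
    have "(\<phi> has_field_derivative 1) (at (s * 0))"
      using real_holomorphic_DERIV[OF \<phi>(1), of 0] \<delta>1 \<phi>'0 by simp
    from DERIV_chain2[OF this DERIV_cmult_Id] show ?thesis
      by simp
  qed
  have "(A has_field_derivative 1) (at 0)"
    unfolding A_def by (rule derivative_eq_intros D\<phi> refl | simp)+
  then have A'0: "deriv A 0 = 1"
    by (rule DERIV_imp_deriv)
  have A0: "A 0 = 0"
    by (simp add: A_def \<phi>(2))
  obtain \<delta>3 \<tau> where \<delta>3: "\<delta>3 > 0" and \<tau>: "real_holomorphic \<delta>3 \<tau>" "\<tau> 0 = 0"
      "\<And>z. cmod z < \<delta>3 \<Longrightarrow> cmod (\<tau> z) < \<delta>2" "\<And>z. cmod z < \<delta>3 \<Longrightarrow> A (\<tau> z) = z"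
      "\<And>z. cmod z < \<delta>3 \<Longrightarrow> deriv A (\<tau> z) * deriv \<tau> z = 1"
    using real_holomorphic_inverse[OF A \<delta>2 A0 _ zero_less_one] A'0 zero_neq_one by metis
  have \<tau>'0: "deriv \<tau> 0 = 1"
    using \<tau>(5)[of 0] \<delta>3 \<tau>(2) A'0 by simp

  \<comment> \<open>\<open>E x\<close> is the point with real part \<open>x\<close> on the curve where \<open>\<psi>\<close> lies in \<open>(1 + \<i>) \<real>\<close>.\<close>
  define E where "E z = \<phi> ((1 + \<i>) * \<tau> z)" for z
  define R0 where "R0 x = Im (E (of_real x))" for x
  have E: "E holomorphic_on ball 0 \<delta>3"
  proof -
    have "\<tau> ` ball 0 \<delta>3 \<subseteq> ball 0 \<delta>2"
      using \<tau>(3) by auto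
    then show ?thesis
      using holomorphic_on_compose_gen[OF real_holomorphicD(1)[OF \<tau>(1)] hol\<phi>, of "1 + \<i>"]
      unfolding E_def by (simp add: o_def)
  qed
  have "(\<tau> has_field_derivative 1) (at 0)"
    using real_holomorphic_DERIV[OF \<tau>(1), of 0] \<delta>3 \<tau>'0 by simp
  from DERIV_chain2[OF _ this, of "\<lambda>t. \<phi> ((1 + \<i>) * t)" "1 + \<i>"]
  have E'0: "deriv E 0 = 1 + \<i>"
    unfolding E_def using D\<phi>[of "1 + \<i>"] \<tau>(2) by (intro DERIV_imp_deriv) simp
  have E0: "E 0 = 0"
    by (simp add: E_def \<tau>(2) \<phi>(2))

  have E_real: "E (of_real x) = Complex x (R0 x)" "cmod (E (of_real x)) < r" "P x (R0 x) = 0"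
    if "\<bar>x\<bar> < \<delta>3" for x
  proof -
    define t where "t = Re (\<tau> (of_real x))"
    have x: "cmod (of_real x) < \<delta>3"
      using that by simp
    have \<tau>_t: "\<tau> (of_real x) = of_real t"
      using real_holomorphic_real[OF \<tau>(1) that] by (simp add: t_def complex_eq_iff)
    have t: "cmod (of_real t) < \<delta>2"
      using \<tau>(3)[OF x] unfolding \<tau>_t .
    have "\<phi> ((1 - \<i>) * of_real t) = cnj (\<phi> ((1 + \<i>) * of_real t))"
      using real_holomorphicD(2)[OF \<phi>(1) in1(1)[OF t]] by simp
    then have "of_real x = of_real (Re (E (of_real x)))"
      using \<tau>(4)[OF x] unfolding \<tau>_t A_def E_def by (simp add: complex_eq_iff)
    then show E_eq: "E (of_real x) = Complex x (R0 x)"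
      by (simp add: R0_def complex_eq_iff)
    show "cmod (E (of_real x)) < r"
      unfolding E_def \<tau>_t by (intro \<phi>(3) in1 t)
    have "\<psi> (Complex x (R0 x)) = (1 + \<i>) * of_real t"
      unfolding E_eq[symmetric] unfolding E_def \<tau>_t by (intro \<phi>(4) in1 t)
    then show "P x (R0 x) = 0"
      by (simp add: P_def)
  qed

  have sgn_P: "sgn (P x y) = sgn (R0 x - y)" if "\<bar>x\<bar> < \<delta>3" "cmod (Complex x y) < r" for x y
    using P_less[of x y "R0 x"] P_less[of x "R0 x" y] E_real[OF that(1)] that(2)
    by (cases y "R0 x" rule: linorder_cases) auto

  obtain c C where c: "c > 0" "c < \<delta>3" "C > 0"
      "\<And>z. cmod z \<le> c \<Longrightarrow> cmod (E z - (E 0 + deriv E 0 * z)) \<le> C * cmod z ^ 2"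
    using linear_approx[OF E \<delta>3] by metis
  show ?thesis
  proof (rule that[OF c(1,3) r(1)])
    show "smooth_on R0 {-c..c}"
      unfolding R0_def by (rule smooth_on_Im[OF E]) (use c in auto)
    fix x :: real assume x: "\<bar>x\<bar> \<le> c"
    have "\<bar>Im (E (of_real x) - (1 + \<i>) * of_real x)\<bar> \<le> C * x\<^sup>2"
      using c(4)[of "of_real x"] abs_Im_le_cmod[of "E (of_real x) - (1 + \<i>) * of_real x"] x
      by (simp add: E0 E'0)
    then show "\<bar>R0 x - x\<bar> \<le> C * x\<^sup>2"
      by (simp add: R0_def)
    fix y assume y: "cmod (Complex x y) < r"
    then have "cmod (Complex x (- y)) < r"
      by (simp add: cmod_def)
    then have "sgn (Re (F (Complex x y))) = - (sgn (R0 x - y) * sgn (R0 x + y))"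
      using sgn_P[of x y] sgn_P[of x "- y"] x y c(2) \<open>a > 0\<close> Re_F[OF y] by (simp add: sgn_mult sgn_minus)
    also have "\<dots> = sgn (\<bar>y\<bar> - \<bar>R0 x\<bar>)"
      by (auto simp: sgn_if abs_if)
    finally show "sgn (Re (F (Complex x y))) = sgn (\<bar>y\<bar> - \<bar>R0 x\<bar>)" .
  qed
qed

section \<open>The hyperbolic functions in the variable \<open>s = u\<^sup>2\<close>\<close>

text \<open>The entire function \<open>cosh (sqrt s)\<close>, defined by its power series.\<close>

definition cosh_sqrt :: "complex \<Rightarrow> complex" where
  "cosh_sqrt s = (\<Sum>n. 1 / fact (2 * n) * s ^ n)"

text \<open>The entire function \<open>sinh (sqrt s) / sqrt s\<close>, with value \<open>1\<close> at \<open>s = 0\<close>.\<close>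

definition sinhc_sqrt :: "complex \<Rightarrow> complex" where
  "sinhc_sqrt s = (\<Sum>n. 1 / fact (2 * n + 1) * s ^ n)"

lemma cosh_sqrt_sums: "(\<lambda>n. 1 / fact (2 * n) * (u\<^sup>2) ^ n) sums cosh (u :: complex)"
proof -
  have "(\<lambda>n. if even n then u ^ n /\<^sub>R fact n else 0) sums cosh u"
    by (rule cosh_converges)
  also have "?this \<longleftrightarrow> (\<lambda>n. (\<lambda>n. if even n then u ^ n /\<^sub>R fact n else 0) (2 * n)) sums cosh u"
    by (rule sums_mono_reindex[symmetric]) (auto simp: strict_mono_def elim!: evenE)
  finally show ?thesis
    by (simp add: power_mult scaleR_conv_of_real divide_inverse)
qed

lemma cosh_sqrt_power2 [simp]: "cosh_sqrt (u\<^sup>2) = cosh u"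
  unfolding cosh_sqrt_def using cosh_sqrt_sums by (rule sums_unique[symmetric])

lemma diffs_cosh_sqrt: "diffs (\<lambda>n. 1 / fact (2 * n)) n = 1 / fact (2 * n + 1) * (1 / 2 :: complex)"
proof -
  have "fact (2 * Suc n) = of_nat (Suc (2 * n + 1)) * (fact (2 * n + 1) :: complex)"
    using fact_Suc[of "2 * n + 1", where ?'a = complex] by (simp del: fact_Suc)
  also have "of_nat (Suc (2 * n + 1)) = 2 * (of_nat (Suc n) :: complex)"
    by simp
  finally show ?thesis
    by (simp add: diffs_def del: fact_Suc of_nat_Suc mult_Suc_right)
qed

lemma summable_cosh_sqrt: "summable (\<lambda>n. 1 / fact (2 * n) * s ^ n :: complex)"
  using cosh_sqrt_sums[of "csqrt s"] by (simp add: sums_iff)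

lemma summable_sinhc_sqrt: "summable (\<lambda>n. 1 / fact (2 * n + 1) * s ^ n :: complex)"
proof -
  have "summable (\<lambda>n. diffs (\<lambda>n. 1 / fact (2 * n)) n * s ^ n)"
    by (rule termdiff_converges_all[OF summable_cosh_sqrt])
  then have "summable (\<lambda>n. 2 * (diffs (\<lambda>n. 1 / fact (2 * n)) n * s ^ n))"
    by (rule summable_mult)
  then show ?thesis
    unfolding diffs_cosh_sqrt by simp
qed

lemma sinhc_sqrt_power2: "u * sinhc_sqrt (u\<^sup>2) = sinh u"
proof -
  have "(\<lambda>n. if even n then 0 else u ^ n /\<^sub>R fact n) sums sinh u"
    by (rule sinh_converges)
  also have "?this \<longleftrightarrow> (\<lambda>n. (\<lambda>n. if even n then 0 else u ^ n /\<^sub>R fact n) (2 * n + 1)) sums sinh u"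
    by (rule sums_mono_reindex[symmetric]) (auto simp: strict_mono_def elim!: oddE)
  finally have "(\<lambda>n. u * (1 / fact (2 * n + 1) * (u\<^sup>2) ^ n)) sums sinh u"
    by (simp add: power_mult scaleR_conv_of_real divide_inverse mult.left_commute del: fact_Suc)
  moreover have "(\<lambda>n. u * (1 / fact (2 * n + 1) * (u\<^sup>2) ^ n)) sums (u * sinhc_sqrt (u\<^sup>2))"
    unfolding sinhc_sqrt_def by (intro sums_mult summable_sums summable_sinhc_sqrt)
  ultimately show ?thesis
    using sums_unique2 by blast
qed

lemma DERIV_cosh_sqrt: "(cosh_sqrt has_field_derivative sinhc_sqrt s / 2) (at s)"
proof -
  have "(cosh_sqrt has_field_derivative (\<Sum>n. 1 / fact (2 * n + 1) * (1 / 2) * s ^ n)) (at s)"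
    using termdiffs_strong_converges_everywhere[OF summable_cosh_sqrt, of s]
    unfolding cosh_sqrt_def diffs_cosh_sqrt .
  also have "(\<Sum>n. 1 / fact (2 * n + 1) * (1 / 2) * s ^ n) = sinhc_sqrt s / 2"
    unfolding sinhc_sqrt_def using suminf_divide[OF summable_sinhc_sqrt[of s], of 2] by simp
  finally show ?thesis .
qed

lemma sinhc_sqrt_differentiable: "sinhc_sqrt field_differentiable (at s)"
  using termdiffs_strong_converges_everywhere[OF summable_sinhc_sqrt, of s]
  unfolding sinhc_sqrt_def field_differentiable_def by blast

lemma DERIV_sinhc_sqrt_0: "(sinhc_sqrt has_field_derivative 1 / 6) (at 0)"
proof -
  have "(\<Sum>n. diffs (\<lambda>n. 1 / fact (2 * n + 1) :: complex) n * 0 ^ n) = 1 / 6"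
    unfolding powser_zero by (simp add: diffs_def fact_numeral)
  then show ?thesis
    using termdiffs_strong_converges_everywhere[OF summable_sinhc_sqrt, of 0]
    unfolding sinhc_sqrt_def by metis
qed

lemma cosh_sqrt_0 [simp]: "cosh_sqrt 0 = 1"
  using cosh_sqrt_power2[of 0] by simp

lemma sinhc_sqrt_0 [simp]: "sinhc_sqrt 0 = 1"
  unfolding sinhc_sqrt_def powser_zero by simp

lemma cosh_sqrt_cnj: "cosh_sqrt (cnj s) = cnj (cosh_sqrt s)"
proof -
  have "(\<lambda>n. cnj (1 / fact (2 * n) * s ^ n)) sums cnj (cosh_sqrt s)"
    unfolding sums_cnj cosh_sqrt_def by (rule summable_sums[OF summable_cosh_sqrt])
  then show ?thesis
    by (simp add: cosh_sqrt_def sums_iff)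
qed

lemma sinhc_sqrt_cnj: "sinhc_sqrt (cnj s) = cnj (sinhc_sqrt s)"
proof -
  have "(\<lambda>n. cnj (1 / fact (2 * n + 1) * s ^ n)) sums cnj (sinhc_sqrt s)"
    unfolding sums_cnj sinhc_sqrt_def by (rule summable_sums[OF summable_sinhc_sqrt])
  then show ?thesis
    by (simp add: sinhc_sqrt_def sums_iff)
qed

section \<open>The critical value as a function of \<open>\<beta>\<close>\<close>

text \<open>
  Here \<open>w = \<beta> - 1\<close>, \<open>s w\<close> is the square of the critical point, and \<open>F w\<close> is the critical value;
  \<open>\<eta>\<close> prescribes how small the critical points have to be.
\<close>

lemma critical_value_function:
  assumes "\<eta> > 0"
  obtains \<delta> s F where "\<delta> > 0" "real_holomorphic \<delta> F" "F 0 = 0" "deriv F 0 = 0"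
    "deriv (deriv F) 0 = - 2 * of_real (3 / 4)"
    "\<And>w. cmod w < \<delta> \<Longrightarrow> cmod (s w) < \<eta>"
    "\<And>w. cmod w < \<delta> \<Longrightarrow> cosh_sqrt (s w) \<noteq> 0"
    "\<And>w. cmod w < \<delta> \<Longrightarrow> cosh_sqrt (s w) = (1 + w) * sinhc_sqrt (s w)"
    "\<And>w. cmod w < \<delta> \<Longrightarrow> F w = s w / (2 * (1 + w)) - Ln (cosh_sqrt (s w))"
proof -
  have hol: "cosh_sqrt holomorphic_on X" "sinhc_sqrt holomorphic_on X" for X
    unfolding holomorphic_on_def
    using DERIV_cosh_sqrt sinhc_sqrt_differentiable
    by (meson field_differentiable_at_within field_differentiable_def)+
  obtain \<rho>1 where \<rho>1: "\<rho>1 > 0" "\<And>s. cmod s < \<rho>1 \<Longrightarrow> cmod (cosh_sqrt s - 1) < 1"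
    using small_near_zero[OF holomorphic_on_imp_continuous_on[OF hol(1)], of 1 1 1] by auto
  obtain \<rho>2 where \<rho>2: "\<rho>2 > 0" "\<And>s. cmod s < \<rho>2 \<Longrightarrow> cmod (sinhc_sqrt s - 1) < 1"
    using small_near_zero[OF holomorphic_on_imp_continuous_on[OF hol(2)], of 1 1 1] by auto
  define \<rho> where "\<rho> = min \<rho>1 \<rho>2"
  have \<rho>: "\<rho> > 0"
    using \<rho>1 \<rho>2 by (simp add: \<rho>_def)
  have S0: "sinhc_sqrt s \<noteq> 0" if "cmod s < \<rho>" for s
    using \<rho>2(2)[of s] that by (auto simp: \<rho>_def)
  have C_np: "cosh_sqrt s \<notin> \<real>\<^sub>\<le>\<^sub>0" if "cmod s < \<rho>" for s
  proof -
    have "\<bar>Re (cosh_sqrt s - 1)\<bar> < 1"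
      using \<rho>1(2)[of s] that abs_Re_le_cmod[of "cosh_sqrt s - 1"] by (simp add: \<rho>_def)
    then show ?thesis
      by (auto simp: complex_nonpos_Reals_iff)
  qed
  have C0: "cosh_sqrt s \<noteq> 0" if "cmod s < \<rho>" for s
    using C_np[OF that] by auto

  define G where "G s = cosh_sqrt s / sinhc_sqrt s" for s
  define H where "H s = s / (2 * G s) - Ln (cosh_sqrt s)" for s
  have G0: "G s \<noteq> 0" if "cmod s < \<rho>" for s
    using C0 S0 that by (simp add: G_def)
  have G: "real_holomorphic \<rho> G"
  proof (rule real_holomorphicI)
    show "G holomorphic_on ball 0 \<rho>"
      unfolding G_def using S0 by (intro holomorphic_intros hol) auto
  qed (simp add: G_def cosh_sqrt_cnj sinhc_sqrt_cnj)
  have G_minus: "real_holomorphic \<rho> (\<lambda>s. G s - 1)"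
    using G by (auto simp: real_holomorphic_def intro!: holomorphic_intros)
  have H: "real_holomorphic \<rho> H"
  proof (rule real_holomorphicI)
    show "H holomorphic_on ball 0 \<rho>"
      unfolding H_def using G0 C_np by (intro holomorphic_intros hol real_holomorphicD(1)[OF G]) auto
  qed (simp add: H_def real_holomorphicD(2)[OF G] cosh_sqrt_cnj cnj_Ln C_np)

  have DG: "(G has_field_derivative deriv G s) (at s)" if "cmod s < \<rho>" for s
    by (rule real_holomorphic_DERIV[OF G that])
  \<comment> \<open>The logarithmic derivative of \<open>cosh_sqrt\<close> is \<open>1 / (2 * G s)\<close>, so only the derivative of \<open>1 / G\<close>
      survives.\<close>
  have DH: "(H has_field_derivative - s * deriv G s / (2 * (G s)\<^sup>2)) (at s)" if "cmod s < \<rho>" for s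
  proof -
    have "(H has_field_derivative
        (1 * (2 * G s) - s * (2 * deriv G s)) / ((2 * G s) * (2 * G s))
        - inverse (cosh_sqrt s) * (sinhc_sqrt s / 2)) (at s)"
      unfolding H_def using G0[OF that]
      by (intro DERIV_diff DERIV_divide DERIV_ident DERIV_cmult DG that
          DERIV_chain2[OF has_field_derivative_Ln[OF C_np[OF that]] DERIV_cosh_sqrt]) auto
    moreover have "inverse (cosh_sqrt s) * (sinhc_sqrt s / 2) = 1 / (2 * G s)"
      using C0[OF that] S0[OF that] by (simp add: G_def field_simps)
    ultimately show ?thesis
      using G0[OF that] by (elim DERIV_cong) (simp add: field_simps power2_eq_square)
  qed
  have "(G has_field_derivative ((sinhc_sqrt 0 / 2) * sinhc_sqrt 0 - cosh_sqrt 0 * (1 / 6))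
      / (sinhc_sqrt 0 * sinhc_sqrt 0)) (at 0)"
    unfolding G_def by (intro DERIV_divide DERIV_cosh_sqrt DERIV_sinhc_sqrt_0) simp
  then have G'0: "deriv G 0 = 1 / 3"
    by (intro DERIV_imp_deriv) simp
  have DG1: "deriv (\<lambda>s. G s - 1) s = deriv G s" if "cmod s < \<rho>" for s
    using DERIV_diff[OF DG[OF that] DERIV_const[of 1]] by (intro DERIV_imp_deriv) simp

  obtain \<delta> s where \<delta>: "\<delta> > 0" and s: "real_holomorphic \<delta> s" "s 0 = 0"
    "\<And>w. cmod w < \<delta> \<Longrightarrow> cmod (s w) < \<rho>" "\<And>w. cmod w < \<delta> \<Longrightarrow> cmod (s w) < \<eta>"
    "\<And>w. cmod w < \<delta> \<Longrightarrow> G (s w) - 1 = w"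
    "\<And>w. cmod w < \<delta> \<Longrightarrow> deriv (\<lambda>s. G s - 1) (s w) * deriv s w = 1"
    by (rule real_holomorphic_inverse[OF G_minus \<rho> _ _ assms])
      (use DG1[of 0] G'0 \<rho> in \<open>auto simp: G_def\<close>)
  have Gs: "G (s w) = 1 + w" if "cmod w < \<delta>" for w
    using s(5)[OF that] by (simp add: algebra_simps)
  define F where "F w = H (s w)" for w
  have w0: "1 + w \<noteq> 0" if "cmod w < \<delta>" for w
    using G0[OF s(3)[OF that]] Gs[OF that] by simp

  have DF: "deriv F w = - s w / (2 * (1 + w)\<^sup>2)" if "cmod w < \<delta>" for w
  proof -
    have "(F has_field_derivative - s w * deriv G (s w) / (2 * (G (s w))\<^sup>2) * deriv s w) (at w)"
      unfolding F_def by (rule DERIV_chain2[OF DH[OF s(3)[OF that]] real_holomorphic_DERIV[OF s(1) that]])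
    then have "deriv F w = - s w * deriv G (s w) / (2 * (G (s w))\<^sup>2) * deriv s w"
      by (rule DERIV_imp_deriv)
    also have "\<dots> = - s w * (deriv G (s w) * deriv s w) / (2 * (1 + w)\<^sup>2)"
      unfolding Gs[OF that] by simp
    finally show ?thesis
      using s(6)[OF that] unfolding DG1[OF s(3)[OF that]] by simp
  qed
  have "deriv G 0 * deriv s 0 = 1"
    using s(6)[of 0] \<delta> s(2) DG1[of 0] \<rho> by simp
  then have "deriv s 0 = 3"
    by (simp add: G'0 field_simps)
  then have Ds: "(s has_field_derivative 3) (at 0)"
    using real_holomorphic_DERIV[OF s(1), of 0] \<delta> by simp
  have "((\<lambda>w. - s w / (2 * (1 + w)\<^sup>2)) has_field_derivative - 3 / 2) (at 0)"
    by (rule derivative_eq_intros Ds refl | simp add: s(2))+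
  then have "(deriv F has_field_derivative - 3 / 2) (at 0)"
    by (rule has_field_derivative_transform_within_open[OF _ open_ball[of 0 \<delta>] _ DF[symmetric]])
      (use \<delta> in auto)
  then have F2: "deriv (deriv F) 0 = - 2 * of_real (3 / 4)"
    by (simp add: DERIV_imp_deriv)

  show ?thesis
  proof (rule that[OF \<delta> _ _ _ F2 s(4)])
    show "real_holomorphic \<delta> F"
      unfolding F_def by (rule real_holomorphic_compose[OF H s(1) s(3)])
    show "F 0 = 0"
      by (simp add: F_def H_def s(2))
    show "deriv F 0 = 0"
      using DF[of 0] \<delta> s(2) by simp
    fix w assume w: "cmod w < \<delta>"
    show "cosh_sqrt (s w) \<noteq> 0"
      by (rule C0[OF s(3)[OF w]])
    show "cosh_sqrt (s w) = (1 + w) * sinhc_sqrt (s w)"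
      using Gs[OF w] S0[OF s(3)[OF w]] by (simp add: G_def field_simps)
    show "F w = s w / (2 * (1 + w)) - Ln (cosh_sqrt (s w))"
      by (simp add: F_def H_def Gs[OF w])
  qed
qed

lemma log_cosh_eq_Ln:
  obtains \<kappa> where "\<kappa> > 0" "\<And>v. cmod v < \<kappa> \<Longrightarrow> log_cosh v = Ln (cosh v)"
proof -
  obtain \<rho> where \<rho>: "\<rho> > 0" "ball 0 \<rho> \<subseteq> slit_plane"
    using open_slit_plane zero_in_slit_plane by (meson open_contains_ball)
  have "continuous_on (ball 0 \<rho>) log_cosh"
    by (intro holomorphic_on_imp_continuous_on holomorphic_on_subset[OF log_cosh_holomorphic \<rho>(2)])
  then obtain \<kappa> where \<kappa>: "\<kappa> > 0" "\<kappa> \<le> \<rho>" "\<And>v. cmod v < \<kappa> \<Longrightarrow> cmod (log_cosh v - 0) < 1"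
    using small_near_zero[of \<rho> log_cosh 0 1] \<rho>(1) by auto
  show ?thesis
  proof (rule that[OF \<kappa>(1)])
    fix v assume v: "cmod v < \<kappa>"
    then have slit: "v \<in> slit_plane"
      using \<kappa>(2) \<rho>(2) by (auto simp: subset_iff)
    have "\<bar>Im (log_cosh v)\<bar> < pi"
      using \<kappa>(3)[OF v] abs_Im_le_cmod[of "log_cosh v"] pi_gt3 by simp
    then have "Ln (exp (log_cosh v)) = log_cosh v"
      by (intro Ln_exp) auto
    then show "log_cosh v = Ln (cosh v)"
      by (simp add: exp_log_cosh[OF slit])
  qed
qed

section \<open>The curve separating the signs\<close>

theorem claim1p4:
  fixes c0 :: real and u :: "complex \<Rightarrow> complex"
  assumes "c0 > 0"
    and "cball 0 (10 * sqrt c0) \<subseteq> slit_plane"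
    and "\<And>\<beta>. 0 < cmod (\<beta> - 1) \<Longrightarrow> cmod (\<beta> - 1) \<le> c0 \<Longrightarrow>
           card (crit_points c0 \<beta>) = 3 \<and> crit_points c0 \<beta> = {0, u \<beta>, - u \<beta>}"
  shows "\<exists>c C r :: real. \<exists>R0 :: real \<Rightarrow> real. c > 0 \<and> C > 0 \<and> 0 < r \<and> r \<le> c0 \<and>
    smooth_on R0 {-c..c} \<and>
    (\<forall>\<epsilon>\<in>{-c..c}. \<bar>R0 \<epsilon> - \<epsilon>\<bar> \<le> C * \<epsilon>\<^sup>2) \<and>
    (\<forall>\<epsilon>\<in>{-c..c}. \<forall>R::real. \<forall>\<beta>::complex.
       \<beta> = 1 + of_real \<epsilon> + \<i> * of_real R \<and> 0 < cmod (\<beta> - 1) \<and> cmod (\<beta> - 1) \<le> r \<longrightarrow>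
       (\<bar>R\<bar> < \<bar>R0 \<epsilon>\<bar> \<longrightarrow> Re (hfun \<beta> (u \<beta>)) < 0 \<and> Re (hfun \<beta> (- u \<beta>)) < 0) \<and>
       (\<bar>R\<bar> = \<bar>R0 \<epsilon>\<bar> \<longrightarrow> Re (hfun \<beta> (u \<beta>)) = 0 \<and> Re (hfun \<beta> (- u \<beta>)) = 0) \<and>
       (\<bar>R\<bar> > \<bar>R0 \<epsilon>\<bar> \<longrightarrow> Re (hfun \<beta> (u \<beta>)) > 0 \<and> Re (hfun \<beta> (- u \<beta>)) > 0))"
proof -
  obtain \<kappa> where \<kappa>: "\<kappa> > 0" "\<And>v. cmod v < \<kappa> \<Longrightarrow> log_cosh v = Ln (cosh v)"
    using log_cosh_eq_Ln by metis
  define m where "m = min \<kappa> (10 * sqrt c0)"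
  have "m > 0"
    using \<kappa>(1) assms(1) by (simp add: m_def)
  then have "m\<^sup>2 > 0"
    by simp
  then obtain \<delta> s F where \<delta>: "\<delta> > 0" and F: "real_holomorphic \<delta> F" "F 0 = 0" "deriv F 0 = 0"
      "deriv (deriv F) 0 = - 2 * of_real (3 / 4)"
    and s: "\<And>w. cmod w < \<delta> \<Longrightarrow> cmod (s w) < m\<^sup>2"
      "\<And>w. cmod w < \<delta> \<Longrightarrow> cosh_sqrt (s w) \<noteq> 0"
      "\<And>w. cmod w < \<delta> \<Longrightarrow> cosh_sqrt (s w) = (1 + w) * sinhc_sqrt (s w)"
      "\<And>w. cmod w < \<delta> \<Longrightarrow> F w = s w / (2 * (1 + w)) - Ln (cosh_sqrt (s w))"
    using critical_value_function by metis
  obtain c C r R0 where c: "c > 0" "C > 0" and r: "r > 0" and R0: "smooth_on R0 {-c..c}"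
      "\<And>x. \<bar>x\<bar> \<le> c \<Longrightarrow> \<bar>R0 x - x\<bar> \<le> C * x\<^sup>2"
      "\<And>x y. \<bar>x\<bar> \<le> c \<Longrightarrow> cmod (Complex x y) < r \<Longrightarrow>
         sgn (Re (F (Complex x y))) = sgn (\<bar>y\<bar> - \<bar>R0 x\<bar>)"
    using real_part_sign_curve[OF F(1) \<delta> F(2-4)] zero_less_divide_iff zero_less_numeral by metis

  have hfun_u: "hfun (1 + w) (u (1 + w)) = F w" "hfun (1 + w) (- u (1 + w)) = F w"
    if w: "w \<noteq> 0" "cmod w \<le> c0" "cmod w < \<delta>" for w
  proof -
    \<comment> \<open>A square root of \<open>s w\<close> is a nonzero critical point, hence one of \<open>\<plusminus>u\<close>; evenness of
        \<open>hfun\<close> makes the choice of the root irrelevant.\<close>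
    define v where "v = csqrt (s w)"
    have v2: "v\<^sup>2 = s w"
      by (simp add: v_def)
    have "cmod v ^ 2 < m\<^sup>2"
      using s(1)[OF w(3)] by (simp add: v2 flip: norm_power)
    then have "cmod v < m"
      by (rule power_less_imp_less_base) (use \<open>m > 0\<close> in simp)
    then have v: "cmod v < \<kappa>" "cmod v \<le> 10 * sqrt c0"
      by (auto simp: m_def)
    have "v \<noteq> 0"
      using s(3)[OF w(3)] w(1) v2 by auto
    have cosh_v: "cosh v = (1 + w) * sinhc_sqrt (v\<^sup>2)" "cosh v \<noteq> 0"
      using s(2,3)[OF w(3)] by (simp_all flip: v2)
    then have w1: "1 + w \<noteq> 0" "sinhc_sqrt (v\<^sup>2) \<noteq> 0"
      by auto
    have "tanh v = v / (1 + w)"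
      using w1 by (simp add: tanh_def cosh_v(1) flip: sinhc_sqrt_power2)
    moreover have "v \<in> slit_plane"
      using v(2) assms(2) by auto
    ultimately have "v \<in> crit_points c0 (1 + w)"
      using v(2) w1(1) by (simp add: crit_points_def deriv_hfun)
    then have "v = u (1 + w) \<or> v = - u (1 + w)"
      using assms(3)[of "1 + w"] w \<open>v \<noteq> 0\<close> by auto
    moreover have "hfun (1 + w) v = F w"
      unfolding hfun_def \<kappa>(2)[OF v(1)] s(4)[OF w(3)] v2[symmetric] by simp
    moreover have "hfun (1 + w) (- v) = hfun (1 + w) v"
      by (rule hfun_even[OF \<open>v \<in> slit_plane\<close>])
    ultimately show "hfun (1 + w) (u (1 + w)) = F w" "hfun (1 + w) (- u (1 + w)) = F w"
      by auto
  qed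

  define r' where "r' = min c0 (min \<delta> r / 2)"
  have r': "r' > 0" "r' \<le> c0" "r' < \<delta>" "r' < r"
    using assms(1) \<delta> r by (auto simp: r'_def min_def)
  have sgn_h: "sgn (Re (hfun \<beta> (u \<beta>))) = sgn (\<bar>R\<bar> - \<bar>R0 \<epsilon>\<bar>)"
      "sgn (Re (hfun \<beta> (- u \<beta>))) = sgn (\<bar>R\<bar> - \<bar>R0 \<epsilon>\<bar>)"
    if "\<epsilon> \<in> {-c..c}" "\<beta> = 1 + of_real \<epsilon> + \<i> * of_real R \<and> 0 < cmod (\<beta> - 1) \<and> cmod (\<beta> - 1) \<le> r'"
    for \<epsilon> R \<beta>
  proof -
    have \<beta>: "\<beta> = 1 + Complex \<epsilon> R"
      using that(2) by (simp add: complex_eq_iff)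
    then have *: "Complex \<epsilon> R \<noteq> 0" "cmod (Complex \<epsilon> R) \<le> r'"
      using that(2) by auto
    show "sgn (Re (hfun \<beta> (u \<beta>))) = sgn (\<bar>R\<bar> - \<bar>R0 \<epsilon>\<bar>)"
      "sgn (Re (hfun \<beta> (- u \<beta>))) = sgn (\<bar>R\<bar> - \<bar>R0 \<epsilon>\<bar>)"
      using hfun_u[OF *(1)] R0(3)[of \<epsilon> R] * r' that(1) unfolding \<beta> by auto
  qed
  show ?thesis
  proof (intro exI conjI ballI allI impI)
    show "c > 0" "C > 0" "r' > 0" "r' \<le> c0" "smooth_on R0 {-c..c}"
      by fact+
    show "\<bar>R0 \<epsilon> - \<epsilon>\<bar> \<le> C * \<epsilon>\<^sup>2" if "\<epsilon> \<in> {-c..c}" for \<epsilon>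
      using R0(2)[of \<epsilon>] that by auto
  next
    fix \<epsilon> R :: real and \<beta> :: complex
    assume "\<epsilon> \<in> {-c..c}"
      and "\<beta> = 1 + of_real \<epsilon> + \<i> * of_real R \<and> 0 < cmod (\<beta> - 1) \<and> cmod (\<beta> - 1) \<le> r'"
    note sgn_h = sgn_h[OF this]
    show "Re (hfun \<beta> (u \<beta>)) < 0" "Re (hfun \<beta> (- u \<beta>)) < 0" if "\<bar>R\<bar> < \<bar>R0 \<epsilon>\<bar>"
      using sgn_h that by (simp_all add: sgn_if split: if_splits)
    show "Re (hfun \<beta> (u \<beta>)) = 0" "Re (hfun \<beta> (- u \<beta>)) = 0" if "\<bar>R\<bar> = \<bar>R0 \<epsilon>\<bar>"
      using sgn_h that by (simp_all add: sgn_if split: if_splits)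
    show "Re (hfun \<beta> (u \<beta>)) > 0" "Re (hfun \<beta> (- u \<beta>)) > 0" if "\<bar>R\<bar> > \<bar>R0 \<epsilon>\<bar>"
      using sgn_h that by (simp_all add: sgn_if split: if_splits)
  qed
qed

end
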